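(* Let $\Omega,\Omega_1,\ldots,\Omega_m$ be nonempty closed convex subsets of $\mathbb{R}^n$, at least one of which is bounded, let $\bar p>0$ and $x_0\in\Omega$. For $x,y\in\mathbb{R}^n$ let $$\mathcal{D}(x,\bar p):=\bar p\ln\sum_{i=1}^m\exp\left(\frac{\sqrt{d(x;\Omega_i)^2+\bar p^2}}{\bar p}\right),\qquad \mathcal{G}(x,y,\bar p):=\bar p\ln\sum_{i=1}^m\exp\left(\frac{\sqrt{\|x-\Pi(y;\Omega_i)\|^2+\bar p^2}}{\bar p}\right).$$ Let $\{x_k\}$ be the sequence of exact solutions defined by $x_k:=\arg\min_{x\in\Omega}\mathcal{G}(x,x_{k-1},\bar p)$ for $k\ge 1$. Then $\{x_k\}$ has a subsequence that converges to an optimal solution of the problem $$\text{minimize } \mathcal{D}(x,\bar p)\ \text{ subject to } x\in\Omega.$$ If, further, this problem has a unique optimal solution, then $\{x_k\}$ converges to this optimal solution.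
   Context: $\mathbb{R}^n$ carries the Euclidean norm $\|\cdot\|$. For a nonempty closed convex set $Q\subset\mathbb{R}^n$, $d(x;Q):=\inf\{\|x-q\|\mid q\in Q\}$ and $\Pi(x;Q)$ is the Euclidean projection of $x$ onto $Q$, i.e. the unique $q\in Q$ with $\|x-q\|=d(x;Q)$. The notation $\arg\min_{x\in\Omega}\mathcal{G}(x,y,\bar p)$ denotes the unique minimizer of $\mathcal{G}(\cdot,y,\bar p)$ over $\Omega$. *)

theory Defs
  imports "HOL-Analysis.Analysis"
begin

definition smooth_dist ::
    "nat \<Rightarrow> (nat \<Rightarrow> (real^'n) set) \<Rightarrow> real^'n \<Rightarrow> real \<Rightarrow> real" where
  "smooth_dist m \<Omega>s x p =
     p * ln (\<Sum>i=1..m. exp (sqrt ((infdist x (\<Omega>s i))\<^sup>2 + p\<^sup>2) / p))"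

(* For the nonempty closed convex sets considered, closest_point, defined by choice, is the
   unique Euclidean projection. *)
definition smooth_majorant ::
    "nat \<Rightarrow> (nat \<Rightarrow> (real^'n) set) \<Rightarrow> real^'n \<Rightarrow> real^'n \<Rightarrow> real \<Rightarrow> real" where
  "smooth_majorant m \<Omega>s x y p =
     p * ln (\<Sum>i=1..m. exp (sqrt ((norm (x - closest_point (\<Omega>s i) y))\<^sup>2 + p\<^sup>2) / p))"

definition optimal_solution :: "('a \<Rightarrow> real) \<Rightarrow> 'a set \<Rightarrow> 'a \<Rightarrow> bool" where
  "optimal_solution f S z \<longleftrightarrow> is_arg_min f (\<lambda>x. x \<in> S) z"

end

theory Submission
  imports Defs
begin

text \<open>
  Write \<open>D\<close> for the smoothed distance and \<open>G\<close> for its majorant. The obtuse-angle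
  property of projections gives \<open>G(x, y) \<le> D(x) + \<parallel>x - y\<parallel>\<^sup>2 / (2p)\<close>. As \<open>x\<^sub>k\<^sub>+\<^sub>1\<close> minimizes
  \<open>G(\<cdot>, x\<^sub>k)\<close>, testing with \<open>x\<^sub>k + t (w - x\<^sub>k)\<close> and using convexity of \<open>D\<close> yields
  \<open>D(x\<^sub>k\<^sub>+\<^sub>1) \<le> (1 - t) D(x\<^sub>k) + t D(w) + t\<^sup>2 C\<close> for all \<open>w \<in> \<Omega>\<close>. The values \<open>D(x\<^sub>k)\<close> decrease
  to a limit \<open>L\<close>; dividing by \<open>t\<close> and letting \<open>t \<rightarrow> 0\<close> gives \<open>L \<le> D(w)\<close>. So the iterates form a
  minimizing sequence inside a compact level set.
\<close>

section \<open>The log-sum-exp function\<close>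

text \<open>Log-sum-exp at temperature \<open>p\<close>, a smooth upper approximation of the
  maximum. Taking an arbitrary family \<open>a\<close> makes both the smoothed distance and its
  majorant instances, so monotonicity, translation and convexity are proved only once.\<close>

definition soft_max :: "real \<Rightarrow> 'i set \<Rightarrow> ('i \<Rightarrow> real) \<Rightarrow> real" where
  "soft_max p I a = p * ln (\<Sum>i\<in>I. exp (a i / p))"

context
  fixes p :: real and I :: "'i set"
  assumes p: "p > 0" and fin: "finite I" and ne: "I \<noteq> {}"
begin

lemma sum_exp_pos: "(\<Sum>i\<in>I. exp (a i :: real)) > 0"
  using fin ne by (intro sum_pos) auto

lemma exp_soft_max: "exp (soft_max p I a / p) = (\<Sum>i\<in>I. exp (a i / p))"
  using p sum_exp_pos[of "\<lambda>i. a i / p"] by (simp add: soft_max_def)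

lemma soft_max_mono:
  assumes "\<And>i. i \<in> I \<Longrightarrow> a i \<le> b i"
  shows "soft_max p I a \<le> soft_max p I b"
  unfolding soft_max_def using assms p sum_exp_pos
  by (intro mult_left_mono ln_mono sum_mono) (auto simp: divide_right_mono)

lemma soft_max_add: "soft_max p I (\<lambda>i. a i + c) = soft_max p I a + c"
proof -
  have "(\<Sum>i\<in>I. exp ((a i + c) / p)) = (\<Sum>i\<in>I. exp (a i / p)) * exp (c / p)"
    by (simp add: add_divide_distrib exp_add sum_distrib_right)
  then show ?thesis
    using p sum_exp_pos[of "\<lambda>i. a i / p"] by (simp add: soft_max_def ln_mult distrib_left)
qed

lemma soft_max_ge:
  assumes "i \<in> I"
  shows "a i \<le> soft_max p I a"
proof -
  have "exp (a i / p) \<le> exp (soft_max p I a / p)"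
    unfolding exp_soft_max using fin assms by (intro member_le_sum) auto
  then show ?thesis
    using p by (simp add: divide_le_cancel)
qed

text \<open>Subtracting its soft maximum from a family makes its exponential sum equal to 1. For two
  families normalized in this way, convexity of \<open>exp\<close>, applied term by term, bounds the
  exponential sum of their mixture by 1. Undoing the shift with \<open>soft_max_add\<close> gives
  the claim without H\<ouml>lder's inequality.\<close>

lemma soft_max_convex:
  assumes t: "0 \<le> t" "t \<le> 1"
  shows "soft_max p I (\<lambda>i. (1 - t) * a i + t * b i) \<le> (1 - t) * soft_max p I a + t * soft_max p I b"
proof -
  let ?A = "soft_max p I a" and ?B = "soft_max p I b"
  let ?c = "(1 - t) * ?A + t * ?B"
  have norm1: "(\<Sum>i\<in>I. exp ((f i - soft_max p I f) / p)) = 1" for f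
  proof -
    have "(\<Sum>i\<in>I. exp ((f i - soft_max p I f) / p))
        = (\<Sum>i\<in>I. exp (f i / p)) / exp (soft_max p I f / p)"
      by (simp add: diff_divide_distrib exp_diff sum_divide_distrib)
    then show ?thesis
      by (simp flip: exp_soft_max)
  qed
  have "(\<Sum>i\<in>I. exp (((1 - t) * a i + t * b i + - ?c) / p))
      \<le> (\<Sum>i\<in>I. (1 - t) * exp ((a i - ?A) / p) + t * exp ((b i - ?B) / p))"
  proof (rule sum_mono)
    fix i
    have "((1 - t) * a i + t * b i + - ?c) / p
        = (1 - t) *\<^sub>R ((a i - ?A) / p) + t *\<^sub>R ((b i - ?B) / p)"
      using p by (simp add: field_simps)
    then show "exp (((1 - t) * a i + t * b i + - ?c) / p)
        \<le> (1 - t) * exp ((a i - ?A) / p) + t * exp ((b i - ?B) / p)"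
      using convex_onD[OF exp_convex t] by (metis UNIV_I)
  qed
  also have "\<dots> = 1"
    by (simp add: sum.distrib norm1 flip: sum_distrib_left)
  finally have "exp (soft_max p I (\<lambda>i. (1 - t) * a i + t * b i + - ?c) / p) \<le> 1"
    unfolding exp_soft_max .
  then show ?thesis
    unfolding soft_max_add using p by (simp add: divide_le_0_iff)
qed

lemma continuous_on_soft_max:
  fixes f :: "'a::topological_space \<Rightarrow> 'i \<Rightarrow> real"
  assumes "\<And>i. i \<in> I \<Longrightarrow> continuous_on S (\<lambda>x. f x i)"
  shows "continuous_on S (\<lambda>x. soft_max p I (f x))"
  unfolding soft_max_def using p sum_exp_pos
  by (intro continuous_intros assms) (auto simp: less_imp_neq[THEN not_sym])

end

section \<open>Distances, projections and a square-root estimate\<close>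

text \<open>The convex combination of nearest points to \<open>x\<close> and \<open>y\<close> lies
  in \<open>A\<close>, so it competes in the distance of the combined point.\<close>

lemma convex_on_infdist:
  fixes A :: "'a::euclidean_space set"
  assumes "A \<noteq> {}" "closed A" "convex A"
  shows "convex_on UNIV (\<lambda>x. infdist x A)"
proof (rule convex_onI)
  fix t :: real and x y :: 'a
  assume t: "0 < t" "t < 1"
  obtain a b where a: "a \<in> A" "infdist x A = dist x a" and b: "b \<in> A" "infdist y A = dist y b"
    using infdist_attains_inf[OF assms(2,1)] by metis
  have "(1 - t) *\<^sub>R a + t *\<^sub>R b \<in> A"
    using assms(3) a b t by (simp add: convex_alt)
  then have "infdist ((1 - t) *\<^sub>R x + t *\<^sub>R y) A
      \<le> dist ((1 - t) *\<^sub>R x + t *\<^sub>R y) ((1 - t) *\<^sub>R a + t *\<^sub>R b)"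
    by (rule infdist_le)
  also have "\<dots> = norm ((1 - t) *\<^sub>R (x - a) + t *\<^sub>R (y - b))"
    by (simp add: dist_norm algebra_simps)
  also have "\<dots> \<le> (1 - t) * dist x a + t * dist y b"
    using t by (intro norm_triangle_le) (simp add: dist_norm)
  finally show "infdist ((1 - t) *\<^sub>R x + t *\<^sub>R y) A \<le> (1 - t) * infdist x A + t * infdist y A"
    using a b by simp
qed simp

text \<open>The square root is the Euclidean norm of the pair of the distance and \<open>p\<close>.
  Convex combinations keep the second coordinate \<open>p\<close>, so convexity of the distance and
  the triangle inequality suffice.\<close>

lemma convex_on_sqrt_infdist:
  fixes A :: "'a::euclidean_space set"
  assumes "A \<noteq> {}" "closed A" "convex A"
  shows "convex_on UNIV (\<lambda>x. sqrt ((infdist x A)\<^sup>2 + p\<^sup>2))"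
proof (rule convex_onI)
  fix t :: real and x y :: 'a
  assume t: "0 < t" "t < 1"
  let ?d = "\<lambda>x. infdist x A"
  have "?d ((1 - t) *\<^sub>R x + t *\<^sub>R y) \<le> (1 - t) * ?d x + t * ?d y"
    using convex_onD[OF convex_on_infdist[OF assms], of t x y] t by simp
  then have "sqrt ((?d ((1 - t) *\<^sub>R x + t *\<^sub>R y))\<^sup>2 + p\<^sup>2)
      \<le> sqrt (((1 - t) * ?d x + t * ?d y)\<^sup>2 + p\<^sup>2)"
    by (simp add: power_mono infdist_nonneg)
  also have "\<dots> = norm ((1 - t) *\<^sub>R (?d x, p) + t *\<^sub>R (?d y, p))"
    by (simp add: norm_Pair algebra_simps)
  also have "\<dots> \<le> (1 - t) * norm (?d x, p) + t * norm (?d y, p)"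
    using t by (intro norm_triangle_le) (simp del: scaleR_Pair)
  finally show "sqrt ((?d ((1 - t) *\<^sub>R x + t *\<^sub>R y))\<^sup>2 + p\<^sup>2)
      \<le> (1 - t) * sqrt ((?d x)\<^sup>2 + p\<^sup>2) + t * sqrt ((?d y)\<^sup>2 + p\<^sup>2)"
    by (simp add: norm_Pair)
qed simp

lemma infdist_eq_closest_point:
  fixes A :: "'a::euclidean_space set"
  assumes "A \<noteq> {}" "closed A"
  shows "infdist x A = norm (x - closest_point A x)"
proof (rule antisym)
  show "infdist x A \<le> norm (x - closest_point A x)"
    using infdist_le[OF closest_point_in_set[OF assms(2,1)]] by (simp add: dist_norm)
  obtain a where "a \<in> A" "infdist x A = dist x a"
    using infdist_attains_inf[OF assms(2,1)] by metis
  then show "norm (x - closest_point A x) \<le> infdist x A"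
    using closest_point_le[OF assms(2), of a x] by (simp add: dist_norm)
qed

lemma norm_diff_closest_point_le:
  fixes A :: "'a::euclidean_space set"
  assumes "A \<noteq> {}" "closed A" "convex A"
  shows "(norm (x - closest_point A y))\<^sup>2 \<le> (infdist x A)\<^sup>2 + (norm (x - y))\<^sup>2"
proof -
  define a b where "a = closest_point A y" and "b = closest_point A x"
  have "b \<in> A"
    unfolding b_def using assms by (intro closest_point_in_set)
  then have "(y - a) \<bullet> (b - a) \<le> 0"
    unfolding a_def using assms by (intro closest_point_dot)
  \<comment> \<open>Expand with \<open>x - b = (x - y) + (y - a) - (b - a)\<close> and
    \<open>x - a = (x - y) + (y - a)\<close>. What remains is a square minus twice the obtuse-angle
    product, hence nonnegative.\<close>
  moreover have "(norm (x - b))\<^sup>2 + (norm (x - y))\<^sup>2 - (norm (x - a))\<^sup>2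
      = (norm ((x - y) - (b - a)))\<^sup>2 - 2 * ((y - a) \<bullet> (b - a))"
    by (simp add: power2_norm_eq_inner inner_diff_left inner_diff_right inner_commute)
  ultimately have "(norm (x - a))\<^sup>2 \<le> (norm (x - b))\<^sup>2 + (norm (x - y))\<^sup>2"
    using zero_le_power2[of "norm ((x - y) - (b - a))"] by linarith
  then show ?thesis
    by (simp add: infdist_eq_closest_point[OF assms(1,2)] a_def b_def)
qed

text \<open>A tangent-line bound: the slope of the square root at \<open>a\<close> is at most
  \<open>1 / (2 * p)\<close>. After squaring, the cross term on the right alone already dominates
  \<open>h\<close>.\<close>

lemma sqrt_add_le:
  fixes a h p :: real
  assumes "p > 0" "p\<^sup>2 \<le> a" "0 \<le> h"
  shows "sqrt (a + h) \<le> sqrt a + h / (2 * p)"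
proof (rule real_le_lsqrt)
  have sa: "p \<le> sqrt a"
    using assms by (simp add: real_le_rsqrt)
  have "p * h \<le> sqrt a * h"
    using sa assms(3) by (rule mult_right_mono)
  then have "h \<le> 2 * sqrt a * (h / (2 * p))"
    using assms(1) by (simp add: field_simps)
  moreover have "(sqrt a)\<^sup>2 = a"
    by (rule real_sqrt_pow2[OF order_trans[OF zero_le_power2 assms(2)]])
  moreover have "(sqrt a + h / (2 * p))\<^sup>2
      = (sqrt a)\<^sup>2 + 2 * sqrt a * (h / (2 * p)) + (h / (2 * p))\<^sup>2"
    by (rule power2_sum[THEN trans]) simp
  ultimately show "a + h \<le> (sqrt a + h / (2 * p))\<^sup>2"
    using zero_le_power2[of "h / (2 * p)"] by linarith
  show "0 \<le> sqrt a + h / (2 * p)"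
    using order_trans[OF less_imp_le[OF assms(1)] sa] assms
    by (intro add_nonneg_nonneg divide_nonneg_pos) simp_all
qed

section \<open>Minimizers and minimizing sequences\<close>

text \<open>For a possibly unbounded \<open>S\<close>: a minimizer over the compact sublevel set of
  \<open>y\<close> is global, since all other points of \<open>S\<close> have values above
  \<open>f y\<close>.\<close>

lemma continuous_attains_inf_sublevel:
  fixes f :: "'a::heine_borel \<Rightarrow> real"
  assumes "continuous_on UNIV f" "closed S" "y \<in> S" "bounded {x \<in> S. f x \<le> f y}"
  shows "\<exists>x\<in>S. \<forall>z\<in>S. f x \<le> f z"
proof -
  let ?K = "{x \<in> S. f x \<le> f y}"
  have "?K = S \<inter> {x. f x \<le> f y}"
    by auto
  then have "compact ?K"
    using assms by (auto simp: compact_eq_bounded_closed intro!: closed_Int closed_Collect_le continuous_on_const)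
  moreover have "?K \<noteq> {}"
    using assms by auto
  moreover have "continuous_on ?K f"
    using assms(1) continuous_on_subset by blast
  ultimately have "\<exists>x\<in>?K. \<forall>z\<in>?K. f x \<le> f z"
    by (rule continuous_attains_inf)
  then obtain x where "x \<in> ?K" "\<forall>z\<in>?K. f x \<le> f z"
    by (rule bexE)
  then show ?thesis
    by force
qed

lemma minimizing_sequence_subseq:
  fixes f :: "'a::metric_space \<Rightarrow> real"
  assumes "compact K" "continuous_on K f" "\<And>k. x k \<in> K"
    and "(\<lambda>k. f (x k)) \<longlonglongrightarrow> L"
  shows "\<exists>r z. strict_mono r \<and> (x \<circ> r) \<longlonglongrightarrow> z \<and> z \<in> K \<and> f z = L"
proof -
  obtain z and r :: "nat \<Rightarrow> nat" where z: "z \<in> K" "strict_mono r" "(x \<circ> r) \<longlonglongrightarrow> z"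
    using assms(1,3) unfolding compact_def by metis
  have "(\<lambda>k. f ((x \<circ> r) k)) \<longlonglongrightarrow> f z"
    using assms(3) by (intro continuous_on_tendsto_compose[OF assms(2) z(3,1)]) auto
  moreover have "(\<lambda>k. f ((x \<circ> r) k)) \<longlonglongrightarrow> L"
    using LIMSEQ_subseq_LIMSEQ[OF assms(4) z(2)] by (simp add: comp_def)
  ultimately show ?thesis
    using z LIMSEQ_unique by blast
qed

lemma minimizing_sequence_tendsto:
  fixes f :: "'a::metric_space \<Rightarrow> real"
  assumes K: "compact K" "continuous_on K f" "\<And>k. x k \<in> K"
    and lim: "(\<lambda>k. f (x k)) \<longlonglongrightarrow> L"
    and uniq: "\<And>w. w \<in> K \<Longrightarrow> f w \<le> L \<Longrightarrow> w = z"
  shows "x \<longlonglongrightarrow> z"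
proof (rule tendstoI)
  fix e :: real
  assume "e > 0"
  let ?C = "K - ball z e"
  show "\<forall>\<^sub>F k in sequentially. dist (x k) z < e"
  proof (cases "?C = {}")
    case True
    then have "dist (x k) z < e" for k
      using K(3)[of k] by (auto simp: dist_commute)
    then show ?thesis
      by simp
  next
    case False
    have "compact ?C" "continuous_on ?C f"
      using K by (auto intro: compact_diff continuous_on_subset)
    then obtain w where w: "w \<in> ?C" "\<forall>v\<in>?C. f w \<le> f v"
      using continuous_attains_inf[OF _ False] by (metis (no_types))
    \<comment> \<open>As \<open>w\<close> lies outside a ball of positive radius around
      \<open>z\<close>, it differs from \<open>z\<close>, so \<open>uniq\<close> excludes
      \<open>f w \<le> L\<close>. Once \<open>f (x k)\<close> drops below \<open>f w\<close>, the
      minimum of \<open>f\<close> off the ball, \<open>x k\<close> must be inside the ball.\<close>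
    have "L < f w"
      using w(1) uniq[of w] \<open>e > 0\<close> by force
    from order_tendstoD(2)[OF lim this] show ?thesis
    proof eventually_elim
      case (elim k)
      then show ?case
        using w(2) K(3)[of k] by (force simp: dist_commute)
    qed
  qed
qed

section \<open>The smoothed distance and its majorant\<close>

context
  fixes m :: nat and \<Omega>s :: "nat \<Rightarrow> (real^'n) set" and p :: real
  assumes m: "m \<ge> 1" and p: "p > 0"
    and sets: "\<forall>i\<in>{1..m}. \<Omega>s i \<noteq> {} \<and> closed (\<Omega>s i) \<and> convex (\<Omega>s i)"
begin

lemma smooth_dist_soft_max:
  "smooth_dist m \<Omega>s x p = soft_max p {1..m} (\<lambda>i. sqrt ((infdist x (\<Omega>s i))\<^sup>2 + p\<^sup>2))"
  by (simp add: smooth_dist_def soft_max_def)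

lemma smooth_majorant_soft_max:
  "smooth_majorant m \<Omega>s x y p
    = soft_max p {1..m} (\<lambda>i. sqrt ((norm (x - closest_point (\<Omega>s i) y))\<^sup>2 + p\<^sup>2))"
  by (simp add: smooth_majorant_def soft_max_def)

lemma continuous_on_smooth_dist: "continuous_on S (\<lambda>x. smooth_dist m \<Omega>s x p)"
  unfolding smooth_dist_soft_max using m p
  by (intro continuous_on_soft_max) (auto intro!: continuous_intros)

lemma continuous_on_smooth_majorant: "continuous_on S (\<lambda>x. smooth_majorant m \<Omega>s x y p)"
  unfolding smooth_majorant_soft_max using m p
  by (intro continuous_on_soft_max) (auto intro!: continuous_intros)

lemma infdist_le_smooth_dist:
  assumes "i \<in> {1..m}"
  shows "infdist x (\<Omega>s i) \<le> smooth_dist m \<Omega>s x p"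
proof -
  have "infdist x (\<Omega>s i) \<le> sqrt ((infdist x (\<Omega>s i))\<^sup>2 + p\<^sup>2)"
    by (simp add: real_le_rsqrt)
  also have "\<dots> \<le> smooth_dist m \<Omega>s x p"
    unfolding smooth_dist_soft_max using assms p by (intro soft_max_ge) auto
  finally show ?thesis .
qed

lemma norm_le_smooth_majorant:
  assumes "i \<in> {1..m}"
  shows "norm (x - closest_point (\<Omega>s i) y) \<le> smooth_majorant m \<Omega>s x y p"
proof -
  have "norm (x - closest_point (\<Omega>s i) y) \<le> sqrt ((norm (x - closest_point (\<Omega>s i) y))\<^sup>2 + p\<^sup>2)"
    by (simp add: real_le_rsqrt)
  also have "\<dots> \<le> smooth_majorant m \<Omega>s x y p"
    unfolding smooth_majorant_soft_max using assms p by (intro soft_max_ge) auto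
  finally show ?thesis .
qed

lemma smooth_dist_le_majorant: "smooth_dist m \<Omega>s x p \<le> smooth_majorant m \<Omega>s x y p"
  unfolding smooth_dist_soft_max smooth_majorant_soft_max
proof (rule soft_max_mono)
  fix i
  assume "i \<in> {1..m}"
  then have "infdist x (\<Omega>s i) \<le> norm (x - closest_point (\<Omega>s i) y)"
    using infdist_le[OF closest_point_in_set[of "\<Omega>s i" y], of x] sets by (simp flip: dist_norm)
  then show "sqrt ((infdist x (\<Omega>s i))\<^sup>2 + p\<^sup>2)
      \<le> sqrt ((norm (x - closest_point (\<Omega>s i) y))\<^sup>2 + p\<^sup>2)"
    by (simp add: power_mono infdist_nonneg)
qed (use m p in auto)

text \<open>The projection inequality and \<open>sqrt_add_le\<close> raise every entry by at most
  the same amount, independent of \<open>i\<close>, so \<open>soft_max_add\<close> moves it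
  outside.\<close>

lemma smooth_majorant_le:
  "smooth_majorant m \<Omega>s x y p \<le> smooth_dist m \<Omega>s x p + (norm (x - y))\<^sup>2 / (2 * p)"
proof -
  have "smooth_majorant m \<Omega>s x y p \<le> soft_max p {1..m}
      (\<lambda>i. sqrt ((infdist x (\<Omega>s i))\<^sup>2 + p\<^sup>2) + (norm (x - y))\<^sup>2 / (2 * p))"
    unfolding smooth_majorant_soft_max
  proof (rule soft_max_mono)
    fix i
    assume "i \<in> {1..m}"
    then have "sqrt ((norm (x - closest_point (\<Omega>s i) y))\<^sup>2 + p\<^sup>2)
        \<le> sqrt (((infdist x (\<Omega>s i))\<^sup>2 + p\<^sup>2) + (norm (x - y))\<^sup>2)"
      using norm_diff_closest_point_le[of "\<Omega>s i" x y] sets by simp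
    also have "\<dots> \<le> sqrt ((infdist x (\<Omega>s i))\<^sup>2 + p\<^sup>2) + (norm (x - y))\<^sup>2 / (2 * p)"
      using p by (intro sqrt_add_le) auto
    finally show "sqrt ((norm (x - closest_point (\<Omega>s i) y))\<^sup>2 + p\<^sup>2)
        \<le> sqrt ((infdist x (\<Omega>s i))\<^sup>2 + p\<^sup>2) + (norm (x - y))\<^sup>2 / (2 * p)" .
  qed (use m p in auto)
  also have "\<dots> = smooth_dist m \<Omega>s x p + (norm (x - y))\<^sup>2 / (2 * p)"
    unfolding smooth_dist_soft_max using m p by (intro soft_max_add) auto
  finally show ?thesis .
qed

lemma smooth_majorant_same: "smooth_majorant m \<Omega>s y y p = smooth_dist m \<Omega>s y p"
  using smooth_majorant_le[of y y] smooth_dist_le_majorant[of y y] by simp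

lemma convex_on_smooth_dist: "convex_on UNIV (\<lambda>x. smooth_dist m \<Omega>s x p)"
proof (rule convex_onI)
  fix t :: real and x y :: "real^'n"
  assume t: "0 < t" "t < 1"
  let ?s = "\<lambda>x i. sqrt ((infdist x (\<Omega>s i))\<^sup>2 + p\<^sup>2)"
  have "soft_max p {1..m} (?s ((1 - t) *\<^sub>R x + t *\<^sub>R y))
      \<le> soft_max p {1..m} (\<lambda>i. (1 - t) * ?s x i + t * ?s y i)"
    using sets t m p by (intro soft_max_mono convex_onD[OF convex_on_sqrt_infdist]) auto
  also have "\<dots> \<le> (1 - t) * soft_max p {1..m} (?s x) + t * soft_max p {1..m} (?s y)"
    using t m p by (intro soft_max_convex) auto
  finally show "smooth_dist m \<Omega>s ((1 - t) *\<^sub>R x + t *\<^sub>R y) p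
      \<le> (1 - t) * smooth_dist m \<Omega>s x p + t * smooth_dist m \<Omega>s y p"
    by (simp only: smooth_dist_soft_max)
qed simp

text \<open>Since \<open>arg_min_on\<close> is a choice operator, its value is a minimizer only once
  one is known to exist. Existence follows from coercivity: the majorant bounds the distance to the
  projection of \<open>y\<close> onto the first set, so its sublevel sets lie in balls.\<close>

lemma arg_min_on_smooth_majorant:
  fixes y :: "real^'n"
  assumes "closed \<Omega>" "\<Omega> \<noteq> {}"
  defines "a \<equiv> arg_min_on (\<lambda>z. smooth_majorant m \<Omega>s z y p) \<Omega>"
  shows "a \<in> \<Omega>" and "\<And>z. z \<in> \<Omega> \<Longrightarrow> smooth_majorant m \<Omega>s a y p \<le> smooth_majorant m \<Omega>s z y p"
proof -
  let ?G = "\<lambda>z. smooth_majorant m \<Omega>s z y p"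
  obtain u where u: "u \<in> \<Omega>"
    using assms(2) by blast
  have "{x \<in> \<Omega>. ?G x \<le> ?G u} \<subseteq> cball (closest_point (\<Omega>s 1) y) (?G u)"
    using order_trans[OF norm_le_smooth_majorant[of 1 _ y]] m
    by (auto simp: dist_norm norm_minus_commute)
  then have "bounded {x \<in> \<Omega>. ?G x \<le> ?G u}"
    by (rule bounded_subset[OF bounded_cball])
  then have "\<exists>x. is_arg_min ?G (\<lambda>x. x \<in> \<Omega>) x"
    using continuous_attains_inf_sublevel[of ?G, OF continuous_on_smooth_majorant assms(1) u]
    by (auto simp: is_arg_min_linorder)
  then have "is_arg_min ?G (\<lambda>x. x \<in> \<Omega>) a"
    unfolding a_def arg_min_on_def arg_min_def by (rule someI_ex)
  then show "a \<in> \<Omega>" and "\<And>z. z \<in> \<Omega> \<Longrightarrow> ?G a \<le> ?G z"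
    by (auto simp: is_arg_min_linorder)
qed

text \<open>Along the segment towards \<open>w\<close> the majorant error is of order
  \<open>t\<^sup>2\<close>, while convexity gives a change linear in \<open>t\<close>; this
  difference in order is what the limit argument exploits.\<close>

lemma smooth_majorant_segment_le:
  assumes "0 \<le> t" "t \<le> 1"
  shows "smooth_majorant m \<Omega>s ((1 - t) *\<^sub>R y + t *\<^sub>R w) y p
    \<le> (1 - t) * smooth_dist m \<Omega>s y p + t * smooth_dist m \<Omega>s w p + t\<^sup>2 * ((norm (w - y))\<^sup>2 / (2 * p))"
proof -
  have "(1 - t) *\<^sub>R y + t *\<^sub>R w - y = t *\<^sub>R (w - y)"
    by (simp add: algebra_simps)
  then have "(norm ((1 - t) *\<^sub>R y + t *\<^sub>R w - y))\<^sup>2 = t\<^sup>2 * (norm (w - y))\<^sup>2"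
    by (simp add: power_mult_distrib)
  then show ?thesis
    using smooth_majorant_le[of "(1 - t) *\<^sub>R y + t *\<^sub>R w" y]
      convex_onD[OF convex_on_smooth_dist assms, of y w] by simp
qed

lemma compact_sublevel_smooth_dist:
  assumes "closed \<Omega>" and bdd: "bounded \<Omega> \<or> (\<exists>i\<in>{1..m}. bounded (\<Omega>s i))"
  shows "compact {w \<in> \<Omega>. smooth_dist m \<Omega>s w p \<le> c}"
proof -
  let ?K = "{w \<in> \<Omega>. smooth_dist m \<Omega>s w p \<le> c}"
  have "?K = \<Omega> \<inter> {w. smooth_dist m \<Omega>s w p \<le> c}"
    by auto
  then have "closed ?K"
    using assms(1) continuous_on_smooth_dist
    by (auto intro!: closed_Int closed_Collect_le continuous_on_const)
  moreover have "bounded ?K"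
    using bdd
  proof
    assume "bounded \<Omega>"
    then show ?thesis
      by (rule bounded_subset) auto
  next
    assume "\<exists>i\<in>{1..m}. bounded (\<Omega>s i)"
    then obtain i where i: "i \<in> {1..m}" "bounded (\<Omega>s i)"
      by blast
    \<comment> \<open>The radius is raised to at least 1 because \<open>compact_infdist_le\<close>
      asks for a positive one and \<open>c\<close> is arbitrary.\<close>
    have "infdist w (\<Omega>s i) \<le> max c 1" if "w \<in> ?K" for w
      using that infdist_le_smooth_dist[OF i(1), of w] by auto
    then have "?K \<subseteq> {w. infdist w (\<Omega>s i) \<le> max c 1}"
      by blast
    moreover have "compact {w. infdist w (\<Omega>s i) \<le> max c 1}"
      using i sets by (intro compact_infdist_le) (auto simp: compact_eq_bounded_closed)
    ultimately show ?thesis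
      using bounded_subset compact_imp_bounded by blast
  qed
  ultimately show ?thesis
    by (simp add: compact_eq_bounded_closed)
qed

end

section \<open>Convergence of the iterates\<close>

theorem corollary4p5:
  fixes \<Omega> :: "(real^'n) set"
    and \<Omega>s :: "nat \<Rightarrow> (real^'n) set"
    and m :: nat
    and p :: real
    and x0 :: "real^'n"
    and x :: "nat \<Rightarrow> real^'n"
  assumes "m \<ge> 1"
    and "\<Omega> \<noteq> {}" and "closed \<Omega>" and "convex \<Omega>"
    and "\<And>i. i \<in> {1..m} \<Longrightarrow> \<Omega>s i \<noteq> {} \<and> closed (\<Omega>s i) \<and> convex (\<Omega>s i)"
    and "bounded \<Omega> \<or> (\<exists>i\<in>{1..m}. bounded (\<Omega>s i))"
    and "p > 0"
    and "x0 \<in> \<Omega>"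
    and "x 0 = x0"
    and "\<And>k. k \<ge> 1 \<Longrightarrow> x k = arg_min_on (\<lambda>z. smooth_majorant m \<Omega>s z (x (k - 1)) p) \<Omega>"
  shows "(\<exists>r z. strict_mono r \<and> (x \<circ> r) \<longlonglongrightarrow> z
            \<and> optimal_solution (\<lambda>z. smooth_dist m \<Omega>s z p) \<Omega> z)
       \<and> (\<forall>z. optimal_solution (\<lambda>z. smooth_dist m \<Omega>s z p) \<Omega> z
            \<and> (\<forall>w. optimal_solution (\<lambda>z. smooth_dist m \<Omega>s z p) \<Omega> w \<longrightarrow> w = z)
            \<longrightarrow> x \<longlonglongrightarrow> z)"
proof -
  let ?D = "\<lambda>z. smooth_dist m \<Omega>s z p" and ?G = "\<lambda>z y. smooth_majorant m \<Omega>s z y p"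
  let ?K = "{w \<in> \<Omega>. ?D w \<le> ?D x0}"
  have "\<forall>i\<in>{1..m}. \<Omega>s i \<noteq> {} \<and> closed (\<Omega>s i) \<and> convex (\<Omega>s i)"
    using assms(5) by blast
  note sets = assms(1,7) this
  have step: "x (Suc k) \<in> \<Omega>" "\<And>z. z \<in> \<Omega> \<Longrightarrow> ?G (x (Suc k)) (x k) \<le> ?G z (x k)" for k
    using arg_min_on_smooth_majorant[OF sets assms(3,2)] assms(10)[of "Suc k"] by auto
  have x_in: "x k \<in> \<Omega>" for k
    using step(1) assms(8,9) by (cases k) auto
  have D_step: "?D (x (Suc k)) \<le> ?G z (x k)" if "z \<in> \<Omega>" for z k
    by (rule order_trans[OF smooth_dist_le_majorant[OF sets] step(2)[OF that]])
  have dec: "decseq (\<lambda>k. ?D (x k))"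
  proof (rule decseq_SucI)
    fix k
    show "?D (x (Suc k)) \<le> ?D (x k)"
      using D_step[OF x_in[of k], of k] by (simp add: smooth_majorant_same[OF sets])
  qed
  have xK: "x k \<in> ?K" for k
    using decseqD[OF dec, of 0 k] x_in assms(9) by simp
  have K: "compact ?K"
    by (rule compact_sublevel_smooth_dist[OF sets assms(3,6)])
  \<comment> \<open>The lower bound that makes the decreasing values converge.\<close>
  have "0 \<le> ?D z" for z
    using infdist_le_smooth_dist[OF sets, of 1 z] infdist_nonneg[of z "\<Omega>s 1"] assms(1) by simp
  then obtain L where L: "(\<lambda>k. ?D (x k)) \<longlonglongrightarrow> L"
    using decseq_convergent[OF dec] by metis
  have L_le: "L \<le> ?D w" if w: "w \<in> \<Omega>" for w
  proof -
    \<comment> \<open>All iterates stay in the bounded set \<open>?K\<close>, so \<open>B\<close>,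
      and with it \<open>C\<close>, can be chosen independently of \<open>k\<close> and
      \<open>t\<close>.\<close>
    obtain B where B: "\<And>v. v \<in> ?K \<Longrightarrow> norm (w - v) \<le> B"
      using bounded_any_center[of ?K w] compact_imp_bounded[OF K] by (auto simp: dist_norm)
    define C where "C = B\<^sup>2 / (2 * p)"
    have t_bound: "L - ?D w \<le> t * C" if t: "0 < t" "t \<le> 1" for t
    proof -
      have "?D (x (Suc k)) \<le> (1 - t) * ?D (x k) + t * ?D w + t\<^sup>2 * C" for k
      proof -
        have "(1 - t) *\<^sub>R x k + t *\<^sub>R w \<in> \<Omega>"
          using assms(4) x_in[of k] w t by (simp add: convex_alt)
        from order_trans[OF D_step[OF this] smooth_majorant_segment_le[OF sets]] t
        have "?D (x (Suc k))
            \<le> (1 - t) * ?D (x k) + t * ?D w + t\<^sup>2 * ((norm (w - x k))\<^sup>2 / (2 * p))"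
          by simp
        moreover have "t\<^sup>2 * ((norm (w - x k))\<^sup>2 / (2 * p)) \<le> t\<^sup>2 * C"
          unfolding C_def using B[OF xK] assms(7)
          by (intro mult_left_mono divide_right_mono power_mono) auto
        ultimately show ?thesis
          by linarith
      qed
      \<comment> \<open>Here \<open>k\<close> tends to infinity with \<open>t\<close> fixed; the
        shifted values on the left have the same limit \<open>L\<close>. Cancelling \<open>L\<close>
        leaves a factor \<open>t\<close> on both sides.\<close>
      then have "L \<le> (1 - t) * L + t * ?D w + t\<^sup>2 * C"
        by (intro LIMSEQ_le[OF LIMSEQ_Suc[OF L],
              where Y = "\<lambda>k. (1 - t) * ?D (x k) + t * ?D w + t\<^sup>2 * C"])
          (auto intro!: tendsto_intros L)
      then have "t * (L - ?D w) \<le> t * (t * C)"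
        by (simp add: algebra_simps power2_eq_square)
      then show ?thesis
        using t by simp
    qed
    have "((\<lambda>t. t * C) \<longlongrightarrow> 0 * C) (at_right 0)"
      by (intro tendsto_intros)
    moreover have "\<forall>\<^sub>F t in at_right 0. L - ?D w \<le> t * C"
      unfolding eventually_at_right_field using t_bound by (intro exI[of _ 1]) auto
    ultimately have "L - ?D w \<le> 0 * C"
      by (intro tendsto_lowerbound) auto
    then show ?thesis
      by simp
  qed
  note min_seq = K continuous_on_smooth_dist[OF sets] xK L
  obtain r z where rz: "strict_mono r" "(x \<circ> r) \<longlonglongrightarrow> z" "z \<in> ?K" "?D z = L"
    using minimizing_sequence_subseq[OF min_seq] by blast
  \<comment> \<open>The cluster point \<open>z\<close> attains \<open>L\<close>, so \<open>L\<close>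
    is the optimal value and the optimal solutions are exactly the points of the level set of
    \<open>L\<close>.\<close>
  have opt: "optimal_solution ?D \<Omega> w \<longleftrightarrow> w \<in> \<Omega> \<and> ?D w \<le> L" for w
    unfolding optimal_solution_def is_arg_min_linorder using L_le rz(3,4) by force
  have "x \<longlonglongrightarrow> w" if "\<forall>v. optimal_solution ?D \<Omega> v \<longrightarrow> v = w" for w
    using that opt by (intro minimizing_sequence_tendsto[OF min_seq]) blast
  then show ?thesis
    using rz opt by auto
qed

end
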